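(* Assume $f$ is globally Lipschitz and of linear growth: there are constants $L,C_f\ge0$ with $\|f(q_1)-f(q_2)\|\le L\|q_1-q_2\|$ and $\|f(q)\|\le C_f(1+\|q\|)$ for all $q_1,q_2,q\in\mathbb{R}^d$. Let $T>0$ and $k\in\mathbb{N}$. Then there is $h_0>0$ such that for all $h\le h_0$ with $N=T/h\in\mathbb{N}$, $$\sup_{n\in\{1,\dots,N\}}\mathbf{E}\big[\|P^h[n]\|^k+\|Q^h[n]\|^k\big]\le C<\infty,$$ where $C$ does not depend on $h$ (it depends on $T$, $k$, the initial value and the coefficients).
   Context: Let $d\le m$, $F\in C^\infty(\mathbb{R}^d,\mathbb{R})$, $f=\nabla F$, $M\in\mathbb{R}^{d\times d}$ symmetric positive definite, $v>0$, $\sigma=(\sigma_1,\dots,\sigma_m)\in\mathbb{R}^{d\times m}$, $W$ a standard $m$-dimensional Wiener process. For a step size $h>0$, $t_n=nh$, $\Delta_{n+1}W=W(t_{n+1})-W(t_n)$, the scheme started at a deterministic $(P^h[0],Q^h[0])=(p,q)$ is $$P^h[n+1]=e^{-vh}P^h[n]-\tfrac{h^2}{2}\nabla^2F(Q^h[n])MP^h[n+1]-h\big(1+\tfrac{vh}{2}\big)e^{-vh}f(Q^h[n])-\big(1+\tfrac{vh}{2}\big)e^{-vh}\sigma\Delta_{n+1}W,$$ $$Q^h[n+1]=Q^h[n]+h\big(1-\tfrac{vh}{2}\big)e^{vh}MP^h[n+1]+\tfrac{h^2}{2}Mf(Q^h[n])+\tfrac{h}{2}M\sigma\Delta_{n+1}W,$$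 with the first equation solved for $P^h[n+1]$. *)

theory Defs
  imports "HOL-Analysis.Analysis" "HOL-Probability.Probability"
begin

text \<open>Gradient and Hessian on R^d (vectors indexed by a finite type), via partial
  derivatives along the standard basis vectors.\<close>

definition grad :: "(real^'d \<Rightarrow> real) \<Rightarrow> real^'d \<Rightarrow> real^'d" where
  "grad F q = (\<chi> i. frechet_derivative F (at q) (axis i 1))"

definition hess :: "(real^'d \<Rightarrow> real) \<Rightarrow> real^'d \<Rightarrow> real^'d^'d" where
  "hess F q = (\<chi> i j. frechet_derivative (\<lambda>x. grad F x $ i) (at q) (axis j 1))"

text \<open>C-infinity: differentiable everywhere, and every partial derivative is again
  C-infinity (greatest fixed point, i.e. all iterated partials exist everywhere).\<close>

coinductive smooth_fun :: "(real^'d \<Rightarrow> real) \<Rightarrow> bool" where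
  "(\<forall>x. g differentiable (at x)) \<Longrightarrow>
   (\<forall>i. smooth_fun (\<lambda>x. frechet_derivative g (at x) (axis i 1))) \<Longrightarrow> smooth_fun g"

definition sym_pos_def_mat :: "real^'d^'d \<Rightarrow> bool" where
  "sym_pos_def_mat A \<longleftrightarrow> transpose A = A \<and> (\<forall>x. x \<noteq> 0 \<longrightarrow> x \<bullet> (A *v x) > 0)"

text \<open>Standard m-dimensional Wiener process on [0,\<infinity>) over the probability space \<Omega>:
  W(0) = 0 a.s., a.s. continuous paths, increments W t - W s (0 \<le> s < t) are
  N(0, (t-s) I_m) distributed, and increments over consecutive intervals of any
  finite partition are independent.\<close>

definition wiener_process :: "'a measure \<Rightarrow> (real \<Rightarrow> 'a \<Rightarrow> real^'m) \<Rightarrow> bool" where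
  "wiener_process \<Omega> W \<longleftrightarrow>
     prob_space \<Omega> \<and>
     (\<forall>t. W t \<in> borel_measurable \<Omega>) \<and>
     (AE \<omega> in \<Omega>. W 0 \<omega> = 0) \<and>
     (AE \<omega> in \<Omega>. continuous_on {0..} (\<lambda>t. W t \<omega>)) \<and>
     (\<forall>s t. 0 \<le> s \<longrightarrow> s < t \<longrightarrow>
        distributed \<Omega> lborel (\<lambda>\<omega>. W t \<omega> - W s \<omega>)
          (\<lambda>x. ennreal (\<Prod>i\<in>UNIV. normal_density 0 (sqrt (t - s)) (x $ i)))) \<and>
     (\<forall>(ts :: nat \<Rightarrow> real) n. 0 \<le> ts 0 \<longrightarrow> (\<forall>i<n. ts i < ts (Suc i)) \<longrightarrow>
        prob_space.indep_vars \<Omega> (\<lambda>_. borel)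
          (\<lambda>i \<omega>. W (ts (Suc i)) \<omega> - W (ts i) \<omega>) {..<n})"

text \<open>The numerical scheme; component 1 is P^h[n], component 2 is Q^h[n].
  The implicit first equation
  (I + h^2/2 Hess F(Q_n) M) P_{n+1} = RHS is solved by applying the matrix inverse.\<close>

primrec scheme ::
  "real \<Rightarrow> real \<Rightarrow> real^'d^'d \<Rightarrow> real^'m^'d \<Rightarrow> (real^'d \<Rightarrow> real) \<Rightarrow>
   real^'d \<Rightarrow> real^'d \<Rightarrow> (real \<Rightarrow> 'a \<Rightarrow> real^'m) \<Rightarrow> nat \<Rightarrow> 'a \<Rightarrow> (real^'d) \<times> (real^'d)" where
  "scheme h v M \<sigma> F p q W 0 \<omega> = (p, q)"
| "scheme h v M \<sigma> F p q W (Suc n) \<omega> =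
     (let PQ = scheme h v M \<sigma> F p q W n \<omega>; P = fst PQ; Q = snd PQ;
          dW = W (real (Suc n) * h) \<omega> - W (real n * h) \<omega>;
          A = mat 1 + (h^2 / 2) *\<^sub>R (hess F Q ** M);
          Pn = matrix_inv A *v
                 (exp (- v * h) *\<^sub>R P
                  - (h * (1 + v * h / 2) * exp (- v * h)) *\<^sub>R grad F Q
                  - ((1 + v * h / 2) * exp (- v * h)) *\<^sub>R (\<sigma> *v dW));
          Qn = Q + (h * (1 - v * h / 2) * exp (v * h)) *\<^sub>R (M *v Pn)
                 + (h^2 / 2) *\<^sub>R (M *v grad F Q)
                 + (h / 2) *\<^sub>R (M *v (\<sigma> *v dW))
      in (Pn, Qn))"

end

theory Submission
  imports Defs
begin

text \<open>The bound is pathwise. Along a fixed Brownian path the scheme is a damped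
  recursion for \<open>(P, Q)\<close> driven by the noise partial sums \<open>D n = \<sigma> (W(t\<^sub>n) - W(0))\<close>.
  Since \<open>\<nabla>f\<close> is \<open>L\<close>-Lipschitz, the Hessian in the implicit momentum update has norm at
  most \<open>d\<^sup>2 L\<close>, so for small \<open>h\<close> the implicit solve perturbs the explicit update by at
  most \<open>h/2\<close> times the new momentum. After shifting \<open>P\<close> and \<open>Q\<close> by multiples of the
  noise, the linear growth of \<open>f\<close> and a discrete Gronwall inequality bound
  \<open>|P n| + |Q n|\<close> by \<open>c\<^sub>1 + c\<^sub>2 |W(t\<^sub>n) - W(0)| + c\<^sub>3 \<cdot> (mean over j \<le> n of |W(t\<^sub>j) - W(0)|)\<close>,
  with constants independent of \<open>h\<close>. Taking \<open>k\<close>-th powers (Jensen for the mean) leaves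
  Gaussian moments \<open>E |W(t) - W(0)|\<^sup>k\<close>, \<open>t \<le> T\<close>, which are bounded uniformly.\<close>

section \<open>Moments of Gaussian increments\<close>

lemma norm_power_le_sum_components:
  fixes x :: "real^'m"
  shows "norm x ^ k \<le> real CARD('m) ^ k * (\<Sum>i\<in>UNIV. 1 + (x $ i) ^ (2*k))"
proof -
  obtain j where j: "\<And>i. \<bar>x $ i\<bar> \<le> \<bar>x $ j\<bar>"
  proof -
    have "Max (range (\<lambda>i. \<bar>x $ i\<bar>)) \<in> range (\<lambda>i. \<bar>x $ i\<bar>)" by (rule Max_in) auto
    then obtain j where "Max (range (\<lambda>i. \<bar>x $ i\<bar>)) = \<bar>x $ j\<bar>" by blast
    moreover have "\<And>i. \<bar>x $ i\<bar> \<le> Max (range (\<lambda>i. \<bar>x $ i\<bar>))" by (auto intro: Max_ge)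
    ultimately show ?thesis using that by metis
  qed
  have "norm x \<le> (\<Sum>i\<in>UNIV. \<bar>x $ i\<bar>)" by (rule norm_le_l1_cart)
  also have "\<dots> \<le> (\<Sum>i\<in>(UNIV::'m set). \<bar>x $ j\<bar>)" by (rule sum_mono) (use j in auto)
  also have "\<dots> = real CARD('m) * \<bar>x $ j\<bar>" by simp
  finally have "norm x ^ k \<le> (real CARD('m) * \<bar>x $ j\<bar>) ^ k" by (rule power_mono) simp
  also have "\<dots> = real CARD('m) ^ k * \<bar>x $ j\<bar> ^ k" by (simp add: power_mult_distrib)
  also have "\<bar>x $ j\<bar> ^ k \<le> 1 + (x $ j) ^ (2*k)"
  proof (cases "\<bar>x $ j\<bar> \<le> 1")
    case True
    then have "\<bar>x $ j\<bar> ^ k \<le> 1" by (simp add: power_le_one)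
    moreover have "0 \<le> (x $ j) ^ (2*k)" by (simp add: power_mult)
    ultimately show ?thesis by linarith
  next
    case False
    then have "\<bar>x $ j\<bar> ^ k \<le> \<bar>x $ j\<bar> ^ (2*k)" by (intro power_increasing) auto
    then show ?thesis by (simp add: power_mult)
  qed
  also have "1 + (x $ j) ^ (2*k) \<le> (\<Sum>i\<in>UNIV. 1 + (x $ i) ^ (2*k))"
    by (rule member_le_sum) (auto simp: power_mult zero_le_even_power)
  finally show ?thesis by (simp add: mult_left_mono)
qed

lemma nn_integral_normal_density_even_moment:
  assumes s: "0 < s"
  shows "(\<integral>\<^sup>+y. ennreal (normal_density 0 s y * (1 + y ^ (2*k))) \<partial>lborel)
          = ennreal (1 + fact (2 * k) / ((2 / s\<^sup>2)^k * fact k))"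
proof -
  have mom: "integrable lborel (\<lambda>y. normal_density 0 s y * y ^ (2*k))"
    "(\<integral>y. normal_density 0 s y * y ^ (2*k) \<partial>lborel) = fact (2 * k) / ((2 / s\<^sup>2)^k * fact k)"
    using integrable_normal_moment[OF s, of 0 "2*k"] integral_normal_moment_even[OF s, of 0 k] by simp_all
  have "integrable lborel (\<lambda>y. normal_density 0 s y * (1 + y ^ (2*k)))"
    using Bochner_Integration.integrable_add[OF integrable_normal_density[OF s] mom(1)] by (simp add: distrib_left)
  moreover have "(\<integral>y. normal_density 0 s y * (1 + y ^ (2*k)) \<partial>lborel)
      = 1 + fact (2 * k) / ((2 / s\<^sup>2)^k * fact k)"
    using Bochner_Integration.integral_add[OF integrable_normal_density[OF s] mom(1)] mom(2)
    by (simp add: distrib_left integral_normal_density[OF s])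
  ultimately show ?thesis
    by (subst nn_integral_eq_integral) (auto simp: power_mult zero_le_even_power)
qed

lemma normal_even_moment_le:
  fixes s :: real
  assumes "0 < s"
  shows "fact (2 * k) / ((2 / s\<^sup>2)^k * fact k) \<le> fact (2 * k) * s ^ (2 * k)"
proof -
  have "fact (2 * k) / ((2 / s\<^sup>2)^k * fact k) = fact (2 * k) * s ^ (2*k) / (2^k * fact k)"
  proof -
    have "(2 / s\<^sup>2)^k = 2^k / s^(2*k)" by (simp add: power_divide power_mult)
    then show ?thesis using assms by (simp add: field_simps)
  qed
  also have "\<dots> \<le> fact (2 * k) * s ^ (2*k)"
    using divide_left_mono[of 1 "2^k * fact k" "fact (2 * k) * s ^ (2*k)"] assms
      fact_ge_1[of k, where 'a=real] one_le_power[of "2::real" k]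
    by (simp add: mult_ge1_I)
  finally show ?thesis .
qed

lemma nn_integral_gaussian_product_component_moment:
  fixes i :: "'m::finite"
  assumes s: "0 < s"
  shows "(\<integral>\<^sup>+x. ennreal ((\<Prod>j\<in>UNIV. normal_density 0 s (x $ j)) * (1 + (x $ i) ^ (2*k))) \<partial>lborel)
          = ennreal (1 + fact (2 * k) / ((2 / s\<^sup>2)^k * fact k))"
proof -
  define g where "g = (\<lambda>b::real^'m. \<lambda>y::real.
    ennreal (normal_density 0 s y * (if b = axis i 1 then 1 + y ^ (2*k) else 1)))"
  have Basis_eq: "(Basis :: (real^'m) set) = range (\<lambda>j. axis j 1)"
    by (auto simp: Basis_vec_def)
  have "ennreal ((\<Prod>j\<in>UNIV. normal_density 0 s (x $ j)) * (1 + (x $ i) ^ (2*k)))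
        = (\<Prod>b\<in>Basis. g b (x \<bullet> b))" for x :: "real^'m"
  proof -
    have "(\<Prod>b\<in>Basis. g b (x \<bullet> b)) = (\<Prod>j\<in>UNIV. g (axis j 1) (x $ j))"
      unfolding Basis_eq
      by (subst prod.reindex) (auto simp: inj_def axis_eq_axis cart_eq_inner_axis inner_commute)
    also have "\<dots> = (\<Prod>j\<in>UNIV. ennreal (normal_density 0 s (x $ j) *
        (if j = i then 1 + (x $ j) ^ (2*k) else 1)))"
      unfolding g_def by (simp add: axis_eq_axis)
    also have "\<dots> = ennreal (\<Prod>j\<in>UNIV. normal_density 0 s (x $ j) *
        (if j = i then 1 + (x $ j) ^ (2*k) else 1))"
      by (rule prod_ennreal) (auto simp: power_mult zero_le_even_power)
    also have "(\<Prod>j\<in>UNIV. normal_density 0 s (x $ j) * (if j = i then 1 + (x $ j) ^ (2*k) else 1))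
        = (\<Prod>j\<in>UNIV. normal_density 0 s (x $ j)) * (1 + (x $ i) ^ (2*k))"
      by (simp add: prod.distrib)
    finally show ?thesis ..
  qed
  then have "(\<integral>\<^sup>+x. ennreal ((\<Prod>j\<in>UNIV. normal_density 0 s (x $ j)) * (1 + (x $ i) ^ (2*k))) \<partial>lborel)
      = (\<integral>\<^sup>+x. (\<Prod>b\<in>Basis. g b (x \<bullet> b)) \<partial>lborel)"
    by simp
  also have "\<dots> = (\<Prod>b\<in>Basis. (\<integral>\<^sup>+y. g b y \<partial>lborel))"
    by (rule nn_integral_lborel_prod) (auto simp: g_def)
  also have "\<dots> = (\<Prod>b\<in>(Basis::(real^'m) set).
      if b = axis i 1 then ennreal (1 + fact (2 * k) / ((2 / s\<^sup>2)^k * fact k)) else 1)"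
  proof (rule prod.cong[OF refl])
    have "(\<integral>\<^sup>+y. ennreal (normal_density 0 s y) \<partial>lborel) = 1"
      using s by (subst nn_integral_eq_integral) auto
    then show "(\<integral>\<^sup>+y. g b y \<partial>lborel) = (if b = axis i 1
        then ennreal (1 + fact (2 * k) / ((2 / s\<^sup>2)^k * fact k)) else 1)" for b
      by (auto simp: g_def nn_integral_normal_density_even_moment[OF s])
  qed
  also have "\<dots> = ennreal (1 + fact (2 * k) / ((2 / s\<^sup>2)^k * fact k))"
    by (subst prod.delta) (auto simp: Basis_vec_def)
  finally show ?thesis .
qed

lemma gaussian_vector_norm_power_moment:
  fixes X :: "'a \<Rightarrow> real^'m"
  assumes X: "distributed \<Omega> lborel X (\<lambda>x. ennreal (\<Prod>i\<in>UNIV. normal_density 0 s (x $ i)))"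
    and s: "0 < s"
  shows "(\<integral>\<^sup>+\<omega>. ennreal (norm (X \<omega>) ^ k) \<partial>\<Omega>)
          \<le> ennreal (real CARD('m) ^ k * (real CARD('m) * (1 + fact (2 * k) * s ^ (2 * k))))"
proof -
  define dens where "dens = (\<lambda>x::real^'m. \<Prod>i\<in>UNIV. normal_density 0 s (x $ i))"
  define c where "c = 1 + fact (2 * k) / ((2 / s\<^sup>2)^k * fact k)"
  have dens_nonneg: "0 \<le> dens x" for x
    unfolding dens_def by (simp add: prod_nonneg)
  have "(\<integral>\<^sup>+\<omega>. ennreal (norm (X \<omega>) ^ k) \<partial>\<Omega>) = (\<integral>\<^sup>+x. ennreal (dens x) * ennreal (norm x ^ k) \<partial>lborel)"
    unfolding dens_def by (rule distributed_nn_integral[OF X, symmetric]) measurable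
  also have "\<dots> \<le> (\<integral>\<^sup>+x. ennreal (real CARD('m) ^ k) *
      (\<Sum>i\<in>UNIV. ennreal (dens x * (1 + (x $ i) ^ (2*k)))) \<partial>lborel)"
  proof (rule nn_integral_mono)
    fix x :: "real^'m"
    have "ennreal (dens x) * ennreal (norm x ^ k) = ennreal (dens x * norm x ^ k)"
      using dens_nonneg by (simp add: ennreal_mult)
    also have "\<dots> \<le> ennreal (dens x * (real CARD('m) ^ k * (\<Sum>i\<in>UNIV. 1 + (x $ i) ^ (2*k))))"
      using dens_nonneg norm_power_le_sum_components[of x k] by (intro ennreal_leI mult_left_mono) auto
    also have "\<dots> = ennreal (real CARD('m) ^ k) * (\<Sum>i\<in>UNIV. ennreal (dens x * (1 + (x $ i) ^ (2*k))))"
      using dens_nonneg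
      by (simp add: ennreal_mult sum_distrib_left mult_ac power_mult zero_le_even_power flip: sum_ennreal)
    finally show "ennreal (dens x) * ennreal (norm x ^ k) \<le> \<dots>" .
  qed
  also have "\<dots> = ennreal (real CARD('m) ^ k) *
      (\<Sum>i\<in>UNIV. \<integral>\<^sup>+x. ennreal (dens x * (1 + (x $ i) ^ (2*k))) \<partial>lborel)"
    unfolding dens_def by (simp add: nn_integral_cmult nn_integral_sum)
  also have "\<dots> = ennreal (real CARD('m) ^ k) * (\<Sum>i\<in>(UNIV::'m set). ennreal c)"
    using s unfolding dens_def c_def by (simp only: nn_integral_gaussian_product_component_moment)
  also have "\<dots> = ennreal (real CARD('m) ^ k * (real CARD('m) * c))"
    unfolding c_def by (simp add: ennreal_mult ennreal_of_nat_eq_real_of_nat)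
  also have "\<dots> \<le> ennreal (real CARD('m) ^ k * (real CARD('m) * (1 + fact (2 * k) * s ^ (2 * k))))"
    using normal_even_moment_le[OF s, of k] unfolding c_def
    by (intro ennreal_leI mult_left_mono) auto
  finally show ?thesis .
qed

lemma wiener_increment_norm_power_moment:
  fixes W :: "real \<Rightarrow> 'a \<Rightarrow> real^'m"
  assumes W: "wiener_process \<Omega> W" and t: "0 \<le> t" "t \<le> T"
  shows "(\<integral>\<^sup>+\<omega>. ennreal (norm (W t \<omega> - W 0 \<omega>) ^ k) \<partial>\<Omega>)
          \<le> ennreal (real CARD('m) ^ k * (real CARD('m) * (1 + fact (2 * k) * T ^ k)))"
proof (cases "t = 0")
  case True
  interpret prob_space \<Omega> using W unfolding wiener_process_def by blast
  have "(\<integral>\<^sup>+\<omega>. ennreal (norm (W t \<omega> - W 0 \<omega>) ^ k) \<partial>\<Omega>) \<le> (\<integral>\<^sup>+\<omega>. 1 \<partial>\<Omega>)"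
    using True by (intro nn_integral_mono) (simp add: power_0_left)
  also have "\<dots> = 1" by (simp add: emeasure_space_1)
  also have "\<dots> \<le> ennreal (real CARD('m) ^ k * (real CARD('m) * (1 + fact (2 * k) * T ^ k)))"
    using t ennreal_leI[of 1] by (simp add: mult_ge1_I)
  finally show ?thesis .
next
  case False
  then have "0 < t" using t by simp
  have Wd: "\<forall>s t. 0 \<le> s \<longrightarrow> s < t \<longrightarrow> distributed \<Omega> lborel (\<lambda>\<omega>. W t \<omega> - W s \<omega>)
      (\<lambda>x. ennreal (\<Prod>i\<in>UNIV. normal_density 0 (sqrt (t - s)) (x $ i)))"
    using W unfolding wiener_process_def by blast
  have "distributed \<Omega> lborel (\<lambda>\<omega>. W t \<omega> - W 0 \<omega>)
      (\<lambda>x. ennreal (\<Prod>i\<in>UNIV. normal_density 0 (sqrt t) (x $ i)))"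
    using Wd[rule_format, of 0 t] \<open>0 < t\<close> by simp
  from gaussian_vector_norm_power_moment[OF this, of k] \<open>0 < t\<close>
  have "(\<integral>\<^sup>+\<omega>. ennreal (norm (W t \<omega> - W 0 \<omega>) ^ k) \<partial>\<Omega>)
      \<le> ennreal (real CARD('m) ^ k * (real CARD('m) * (1 + fact (2 * k) * t ^ k)))"
    by (simp add: power_mult)
  also have "\<dots> \<le> ennreal (real CARD('m) ^ k * (real CARD('m) * (1 + fact (2 * k) * T ^ k)))"
    using t by (intro ennreal_leI mult_left_mono add_left_mono power_mono) auto
  finally show ?thesis .
qed

section \<open>The implicit Hessian correction\<close>

lemma has_derivative_bound_of_lipschitz_at:
  fixes g :: "'a::real_normed_vector \<Rightarrow> real"
  assumes D: "(g has_derivative D) (at q)"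
    and lip: "\<And>y. \<bar>g y - g q\<bar> \<le> L * norm (y - q)"
  shows "\<bar>D u\<bar> \<le> L * norm u"
proof -
  have "((\<lambda>t. q + t *\<^sub>R u) has_derivative (\<lambda>t. t *\<^sub>R u)) (at 0)"
    by (auto intro!: derivative_eq_intros)
  then have "((\<lambda>t. g (q + t *\<^sub>R u)) has_derivative (\<lambda>t. D (t *\<^sub>R u))) (at 0)"
    using has_derivative_compose[of "\<lambda>t. q + t *\<^sub>R u" _ 0 UNIV g D] D by (simp add: comp_def)
  moreover have "(\<lambda>t. D (t *\<^sub>R u)) = (*) (D u)"
    using has_derivative_linear[OF D] by (auto simp: linear_scale)
  ultimately have "((\<lambda>t. g (q + t *\<^sub>R u)) has_field_derivative D u) (at 0)"
    by (simp add: has_field_derivative_def)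
  then have lim: "((\<lambda>t. (g (q + t *\<^sub>R u) - g (q + 0 *\<^sub>R u)) / (t - 0)) \<longlongrightarrow> D u) (at 0)"
    by (simp add: has_field_derivative_iff)
  have "norm (D u) \<le> L * norm u"
  proof (rule Lim_norm_ubound[OF _ lim])
    show "\<forall>\<^sub>F t in at 0. norm ((g (q + t *\<^sub>R u) - g (q + 0 *\<^sub>R u)) / (t - 0)) \<le> L * norm u"
    proof (rule eventually_at_filter[THEN iffD2], intro always_eventually allI impI)
      fix t :: real assume "t \<noteq> 0"
      moreover have "\<bar>g (q + t *\<^sub>R u) - g q\<bar> \<le> \<bar>t\<bar> * (L * norm u)"
        using lip[of "q + t *\<^sub>R u"] by (simp add: mult_ac)
      ultimately show "norm ((g (q + t *\<^sub>R u) - g (q + 0 *\<^sub>R u)) / (t - 0)) \<le> L * norm u"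
        by (simp add: divide_le_eq mult_ac)
    qed
  qed simp
  then show ?thesis by simp
qed

lemma hess_component_bound:
  assumes F: "smooth_fun F"
    and lip: "\<forall>q1 q2. norm (grad F q1 - grad F q2) \<le> L * norm (q1 - q2)"
  shows "\<bar>hess F q $ i $ j\<bar> \<le> L"
proof -
  define g where "g = (\<lambda>x. frechet_derivative F (at x) (axis i 1))"
  have grad_g: "(\<lambda>x. grad F x $ i) = g" unfolding g_def grad_def by simp
  from F have "smooth_fun g" unfolding g_def by (cases rule: smooth_fun.cases) blast
  then have "g differentiable (at q)" by (cases rule: smooth_fun.cases) blast
  then have D: "(g has_derivative frechet_derivative g (at q)) (at q)"
    by (rule frechet_derivative_works[THEN iffD1])
  have "\<bar>g y - g q\<bar> \<le> L * norm (y - q)" for y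
  proof -
    have "\<bar>g y - g q\<bar> = \<bar>(grad F y - grad F q) $ i\<bar>" unfolding grad_g[symmetric] by simp
    also have "\<dots> \<le> norm (grad F y - grad F q)" by (rule component_le_norm_cart)
    also have "\<dots> \<le> L * norm (y - q)" using lip by blast
    finally show ?thesis .
  qed
  from has_derivative_bound_of_lipschitz_at[OF D this, of "axis j 1"]
  show ?thesis unfolding hess_def grad_g[symmetric] by simp
qed

lemma onorm_hess_le:
  fixes F :: "real^'d \<Rightarrow> real"
  assumes "smooth_fun F"
    and "\<forall>q1 q2. norm (grad F q1 - grad F q2) \<le> L * norm (q1 - q2)"
  shows "onorm ((*v) (hess F q)) \<le> real CARD('d) * real CARD('d) * L"
  using hess_component_bound[OF assms] by (rule onorm_le_matrix_component)

lemma matrix_inv_perturbed_identity: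
  fixes E :: "real^'n^'n"
  assumes E: "\<And>x. norm (E *v x) \<le> e * norm x" and e: "e < 1"
  shows "(mat 1 + E) *v (matrix_inv (mat 1 + E) *v y) = y"
proof -
  have "x = 0" if "(mat 1 + E) *v x = 0" for x
  proof -
    from that have "x = - (E *v x)"
      by (simp add: algebra_simps eq_neg_iff_add_eq_0)
    then have "norm x \<le> e * norm x" using E by (metis norm_minus_cancel)
    with e show "x = 0" by (metis mult_le_cancel_right1 norm_le_zero_iff not_less)
  qed
  then have "invertible (mat 1 + E)"
    using matrix_left_invertible_ker invertible_left_inverse by blast
  then have "(mat 1 + E) ** matrix_inv (mat 1 + E) = mat 1"
    unfolding invertible_def matrix_inv_def by (rule someI_ex[THEN conjunct1])
  then show ?thesis by (simp add: matrix_vector_mul_assoc)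
qed

section \<open>A damped splitting recursion\<close>

lemma discrete_gronwall:
  fixes u g :: "nat \<Rightarrow> real"
  assumes step: "\<And>n. u (Suc n) \<le> (1 + a) * u n + g n"
    and a: "0 \<le> a" and g: "\<And>n. 0 \<le> g n"
  shows "u n \<le> (1 + a) ^ n * (u 0 + (\<Sum>j<n. g j))"
proof (induction n)
  case 0
  then show ?case by simp
next
  case (Suc n)
  have "(1 + a) * u n \<le> (1 + a) * ((1 + a) ^ n * (u 0 + (\<Sum>j<n. g j)))"
    using Suc.IH a by (intro mult_left_mono) auto
  moreover have "g n \<le> (1 + a) ^ Suc n * g n"
    using mult_right_mono[OF one_le_power[of "1 + a" "Suc n"] g[of n]] a by simp
  ultimately have "u (Suc n) \<le> (1 + a) ^ Suc n * (u 0 + (\<Sum>j<n. g j)) + (1 + a) ^ Suc n * g n"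
    using step[of n] by (simp add: mult.assoc)
  then show ?case by (simp add: distrib_left add.assoc)
qed

lemma norm_diff_diff_le: "norm (x - y - z) \<le> norm x + norm y + norm z"
  for x y z :: "'a::real_normed_vector"
  using norm_triangle_ineq4[of "x - y" z] norm_triangle_ineq4[of x y] by linarith

lemma norm_diff_add_le: "norm (x - y + z) \<le> norm x + norm y + norm z"
  for x y z :: "'a::real_normed_vector"
  using norm_triangle_ineq[of "x - y" z] norm_triangle_ineq4[of x y] by linarith

lemma norm_add_add_le: "norm (x + y + z) \<le> norm x + norm y + norm z"
  for x y z :: "'a::real_normed_vector"
  using norm_triangle_ineq[of "x + y" z] norm_triangle_ineq[of x y] by linarith

definition splitting_rate :: "real \<Rightarrow> real \<Rightarrow> real \<Rightarrow> real \<Rightarrow> real" where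
  "splitting_rate Cf m0 eV v =
     Cf * (1 + m0) * (1 + m0) + 2 * (2 + Cf * (1 + m0)) * (1 + eV * m0) + v"

locale damped_splitting_recursion =
  fixes P Q D :: "nat \<Rightarrow> 'v::real_normed_vector"
    and f M :: "'v \<Rightarrow> 'v"
    and h a b c e \<epsilon> v m0 eV Cf :: real
  assumes P_Suc: "\<And>n. norm (P (Suc n) - (a *\<^sub>R P n - b *\<^sub>R f (Q n) - c *\<^sub>R (D (Suc n) - D n)))
                    \<le> \<epsilon> * norm (P (Suc n))"
    and Q_Suc: "\<And>n. Q (Suc n) = Q n + e *\<^sub>R M (P (Suc n)) + (h\<^sup>2 / 2) *\<^sub>R M (f (Q n))
                               + (h / 2) *\<^sub>R M (D (Suc n) - D n)"
    and D_0: "D 0 = 0"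
    and h: "0 < h" "h \<le> 1"
    and \<epsilon>: "0 \<le> \<epsilon>" "\<epsilon> \<le> h" "\<epsilon> \<le> 1/2"
    and a: "0 \<le> a" "a \<le> 1" "1 - a \<le> v * h"
    and b: "0 \<le> b" "b \<le> h"
    and c: "0 \<le> c" "c \<le> 1"
    and e: "\<bar>e\<bar> \<le> eV * h" "0 \<le> eV"
    and f: "\<And>x. norm (f x) \<le> Cf * (1 + norm x)" "0 \<le> Cf"
    and M: "linear M" "\<And>x. norm (M x) \<le> m0 * norm x" "0 \<le> m0"
    and v: "0 \<le> v"
begin

text \<open>The residual allowed in \<open>P_Suc\<close> is where the implicit Hessian solve enters.
  The noise increments enter the momentum with a coefficient of order one; the
  shifted variables \<open>U\<close>, \<open>V\<close> (with the damped memory \<open>Y\<close> of past increments)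
  absorb them, so that \<open>R\<close> only grows by \<open>O(h)\<close> per step.\<close>

primrec Y :: "nat \<Rightarrow> 'v" where
  "Y 0 = 0"
| "Y (Suc n) = a *\<^sub>R Y n - ((1 - a) * c) *\<^sub>R D n"

definition U :: "nat \<Rightarrow> 'v" where "U n = P n + Y n + c *\<^sub>R D n"

definition V :: "nat \<Rightarrow> 'v" where "V n = Q n - (h / 2) *\<^sub>R M (D n)"

definition R :: "nat \<Rightarrow> real" where "R n = norm (U n) + norm (V n) + norm (Y n)"

definition G :: "nat \<Rightarrow> real" where "G n = norm (D n) + norm (D (Suc n))"

lemma R_nonneg: "0 \<le> R n" and G_nonneg: "0 \<le> G n"
  unfolding R_def G_def by simp_all

lemma U_Suc: "U (Suc n) = a *\<^sub>R U n - b *\<^sub>R f (Q n)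
    + (P (Suc n) - (a *\<^sub>R P n - b *\<^sub>R f (Q n) - c *\<^sub>R (D (Suc n) - D n)))"
  unfolding U_def by (simp add: algebra_simps)

lemma V_Suc: "V (Suc n) = V n + e *\<^sub>R M (P (Suc n)) + (h\<^sup>2 / 2) *\<^sub>R M (f (Q n))"
  unfolding V_def Q_Suc using M(1) by (simp add: linear_diff algebra_simps)

lemma norm_M_scaled_le: "norm ((h / 2) *\<^sub>R M x) \<le> m0 * norm x"
proof -
  have "norm ((h / 2) *\<^sub>R M x) = \<bar>h / 2\<bar> * norm (M x)" by simp
  also have "\<dots> \<le> 1 * norm (M x)" using h by (intro mult_right_mono) auto
  finally show ?thesis using M(2)[of x] by simp
qed

lemma norm_P_le: "norm (P n) \<le> norm (U n) + norm (Y n) + norm (D n)"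
proof -
  have "norm (P n) = norm (U n - Y n - c *\<^sub>R D n)" unfolding U_def by simp
  also have "\<dots> \<le> norm (U n) + norm (Y n) + norm (c *\<^sub>R D n)"
    by (rule norm_diff_diff_le)
  also have "norm (c *\<^sub>R D n) \<le> norm (D n)" using c by (simp add: mult_left_le_one_le)
  finally show ?thesis by simp
qed

lemma norm_Q_le: "norm (Q n) \<le> norm (V n) + m0 * norm (D n)"
proof -
  have "norm (Q n) = norm (V n + (h / 2) *\<^sub>R M (D n))" unfolding V_def by simp
  also have "\<dots> \<le> norm (V n) + norm ((h / 2) *\<^sub>R M (D n))" by (rule norm_triangle_ineq)
  finally show ?thesis using norm_M_scaled_le[of "D n"] by simp
qed

lemma norm_f_Q_le: "norm (f (Q n)) \<le> Cf * (1 + m0) * (1 + R n + G n)"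
proof -
  have "norm (V n) \<le> R n" "norm (D n) \<le> G n" unfolding R_def G_def by simp_all
  then have "1 + norm (Q n) \<le> 1 + R n + m0 * G n"
    using norm_Q_le[of n] mult_left_mono[of "norm (D n)" "G n" m0] M(3) by linarith
  also have "\<dots> \<le> (1 + m0) * (1 + R n + G n)"
    using mult_nonneg_nonneg[OF M(3), of "1 + R n"] R_nonneg[of n] G_nonneg[of n]
    by (simp add: algebra_simps)
  finally have "1 + norm (Q n) \<le> (1 + m0) * (1 + R n + G n)" .
  then have "Cf * (1 + norm (Q n)) \<le> Cf * ((1 + m0) * (1 + R n + G n))"
    using f(2) by (rule mult_left_mono)
  then show ?thesis using f(1)[of "Q n"] by (simp add: mult.assoc)
qed

lemma norm_P_Suc_le: "norm (P (Suc n)) \<le> 2 * (2 + Cf * (1 + m0)) * (1 + R n + G n)"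
proof -
  define y where "y = a *\<^sub>R P n - b *\<^sub>R f (Q n) - c *\<^sub>R (D (Suc n) - D n)"
  have "norm y \<le> norm (a *\<^sub>R P n) + norm (b *\<^sub>R f (Q n)) + norm (c *\<^sub>R (D (Suc n) - D n))"
    unfolding y_def by (rule norm_diff_diff_le)
  also have "\<dots> \<le> norm (P n) + norm (f (Q n)) + norm (D (Suc n) - D n)"
    using a b c h by (intro add_mono) (simp_all add: mult_left_le_one_le)
  also have "\<dots> \<le> (R n + G n) + Cf * (1 + m0) * (1 + R n + G n) + G n"
    using norm_P_le[of n] norm_f_Q_le[of n] norm_triangle_ineq4[of "D (Suc n)" "D n"]
      norm_ge_zero[of "V n"] norm_ge_zero[of "D (Suc n)"]
    unfolding R_def G_def by (intro add_mono) linarith+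
  also have "\<dots> \<le> (2 + Cf * (1 + m0)) * (1 + R n + G n)"
    using R_nonneg[of n] by (simp add: algebra_simps)
  finally have y: "norm y \<le> (2 + Cf * (1 + m0)) * (1 + R n + G n)" .
  have "norm (P (Suc n)) \<le> norm y + norm (P (Suc n) - y)"
    using norm_triangle_ineq[of y "P (Suc n) - y"] by simp
  also have "norm (P (Suc n) - y) \<le> 1/2 * norm (P (Suc n))"
    using P_Suc[of n] mult_right_mono[OF \<epsilon>(3) norm_ge_zero[of "P (Suc n)"]]
    unfolding y_def by linarith
  finally have "norm (P (Suc n)) \<le> 2 * norm y" by simp
  with y show ?thesis unfolding mult.assoc by linarith
qed

lemma norm_U_Suc_le:
  "norm (U (Suc n)) \<le> norm (U n) + h * (Cf * (1 + m0) + 2 * (2 + Cf * (1 + m0))) * (1 + R n + G n)"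
proof -
  have "norm (U (Suc n)) \<le> norm (a *\<^sub>R U n) + norm (b *\<^sub>R f (Q n))
      + norm (P (Suc n) - (a *\<^sub>R P n - b *\<^sub>R f (Q n) - c *\<^sub>R (D (Suc n) - D n)))"
    unfolding U_Suc by (rule norm_diff_add_le)
  also have "norm (a *\<^sub>R U n) \<le> norm (U n)" using a by (simp add: mult_left_le_one_le)
  also have "norm (b *\<^sub>R f (Q n)) \<le> h * (Cf * (1 + m0) * (1 + R n + G n))"
    using b norm_f_Q_le[of n] by (simp add: mult_mono)
  also have "norm (P (Suc n) - (a *\<^sub>R P n - b *\<^sub>R f (Q n) - c *\<^sub>R (D (Suc n) - D n)))
      \<le> h * (2 * (2 + Cf * (1 + m0)) * (1 + R n + G n))"
    using P_Suc[of n] mult_mono[OF \<epsilon>(2) norm_P_Suc_le[of n]] \<epsilon>(1) h(1) by simp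
  finally show ?thesis by (simp add: algebra_simps)
qed

lemma norm_V_Suc_le:
  "norm (V (Suc n)) \<le> norm (V n)
     + h * (eV * m0 * (2 * (2 + Cf * (1 + m0))) + m0 * (Cf * (1 + m0))) * (1 + R n + G n)"
proof -
  have "norm (V (Suc n)) \<le> norm (V n) + norm (e *\<^sub>R M (P (Suc n))) + norm ((h\<^sup>2 / 2) *\<^sub>R M (f (Q n)))"
    unfolding V_Suc by (rule norm_add_add_le)
  also have "norm (e *\<^sub>R M (P (Suc n))) \<le> (eV * h) * (m0 * (2 * (2 + Cf * (1 + m0)) * (1 + R n + G n)))"
  proof -
    have "norm (M (P (Suc n))) \<le> m0 * (2 * (2 + Cf * (1 + m0)) * (1 + R n + G n))"
      using M(2)[of "P (Suc n)"] mult_left_mono[OF norm_P_Suc_le[of n] M(3)] by linarith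
    then show ?thesis using mult_mono[OF e(1)] e(2) h(1) by simp
  qed
  also have "norm ((h\<^sup>2 / 2) *\<^sub>R M (f (Q n))) \<le> h * (m0 * (Cf * (1 + m0) * (1 + R n + G n)))"
  proof -
    have "h\<^sup>2 / 2 \<le> h" using h by (simp add: power2_eq_square mult_left_le_one_le)
    moreover have "norm (M (f (Q n))) \<le> m0 * (Cf * (1 + m0) * (1 + R n + G n))"
      using M(2)[of "f (Q n)"] mult_left_mono[OF norm_f_Q_le[of n] M(3)] by linarith
    ultimately have "h\<^sup>2 / 2 * norm (M (f (Q n))) \<le> h * (m0 * (Cf * (1 + m0) * (1 + R n + G n)))"
      using h(1) by (intro mult_mono) auto
    then show ?thesis by simp
  qed
  finally show ?thesis by (simp add: algebra_simps)
qed

lemma norm_Y_Suc_le: "norm (Y (Suc n)) \<le> norm (Y n) + h * v * (1 + R n + G n)"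
proof -
  have "norm (Y (Suc n)) \<le> norm (a *\<^sub>R Y n) + norm (((1 - a) * c) *\<^sub>R D n)"
    unfolding Y.simps by (rule norm_triangle_ineq4)
  also have "norm (a *\<^sub>R Y n) \<le> norm (Y n)" using a by (simp add: mult_left_le_one_le)
  also have "norm (((1 - a) * c) *\<^sub>R D n) \<le> (v * h) * (1 + R n + G n)"
  proof -
    have "(1 - a) * c \<le> 1 - a" using a c by (simp add: mult_left_le)
    then have "(1 - a) * c \<le> v * h" using a(3) by linarith
    moreover have "norm (D n) \<le> 1 + R n + G n" using R_nonneg[of n] unfolding G_def by simp
    ultimately show ?thesis using a c by (simp add: mult_mono)
  qed
  finally show ?thesis by (simp add: mult.commute)
qed

lemma R_Suc_le: "R (Suc n) \<le> (1 + h * splitting_rate Cf m0 eV v) * R n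
    + h * splitting_rate Cf m0 eV v * (1 + G n)"
  using norm_U_Suc_le[of n] norm_V_Suc_le[of n] norm_Y_Suc_le[of n]
  unfolding R_def[of "Suc n"] splitting_rate_def by (simp add: R_def algebra_simps)

lemma sum_G_le: "(\<Sum>j<n. G j) \<le> 2 * (\<Sum>j\<le>n. norm (D j))"
proof -
  have "(\<Sum>j<n. norm (D j)) \<le> (\<Sum>j\<le>n. norm (D j))"
    by (intro sum_mono2) auto
  moreover have "(\<Sum>j<n. norm (D (Suc j))) \<le> (\<Sum>j\<le>n. norm (D j))"
    using sum.atMost_shift[of "\<lambda>j. norm (D j)" n] by (simp add: D_0)
  ultimately show ?thesis unfolding G_def by (simp add: sum.distrib)
qed

theorem norm_P_add_norm_Q_le:
  "norm (P n) + norm (Q n) \<le> (1 + h * splitting_rate Cf m0 eV v) ^ n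
      * (norm (P 0) + norm (Q 0) + h * splitting_rate Cf m0 eV v * (n + 2 * (\<Sum>j\<le>n. norm (D j))))
    + (1 + m0) * norm (D n)"
proof -
  let ?K = "splitting_rate Cf m0 eV v"
  have K: "0 \<le> ?K" using f(2) M(3) e(2) v unfolding splitting_rate_def by simp
  have "R n \<le> (1 + h * ?K) ^ n * (R 0 + (\<Sum>j<n. h * ?K * (1 + G j)))"
    using R_Suc_le K h G_nonneg by (intro discrete_gronwall) auto
  also have "R 0 = norm (P 0) + norm (Q 0)" unfolding R_def U_def V_def by (simp add: D_0 linear_0[OF M(1)])
  also have "(\<Sum>j<n. h * ?K * (1 + G j)) = h * ?K * (n + (\<Sum>j<n. G j))"
    by (simp add: sum.distrib flip: sum_distrib_left)
  also have "\<dots> \<le> h * ?K * (n + 2 * (\<Sum>j\<le>n. norm (D j)))"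
    using sum_G_le[of n] K h by (intro mult_left_mono) auto
  finally have "R n \<le> (1 + h * ?K) ^ n
      * (norm (P 0) + norm (Q 0) + h * ?K * (n + 2 * (\<Sum>j\<le>n. norm (D j))))"
    using K h by (simp add: mult_left_mono)
  moreover have "norm (P n) + norm (Q n) \<le> R n + (1 + m0) * norm (D n)"
    using norm_P_le[of n] norm_Q_le[of n] unfolding R_def by (simp add: algebra_simps)
  ultimately show ?thesis by simp
qed

end

section \<open>Moment bounds for the scheme\<close>

lemma exp_neg_damping_le_one: "0 \<le> x \<Longrightarrow> (1 + x / 2) * exp (- x) \<le> 1"
  for x :: real
proof -
  assume "0 \<le> x"
  then have "1 + x / 2 \<le> exp x" using exp_ge_add_one_self[of x] by linarith
  then have "(1 + x / 2) * exp (- x) \<le> exp x * exp (- x)" by (intro mult_right_mono) auto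
  then show ?thesis by (simp add: exp_minus_inverse)
qed

lemma power_mean_le_mean_power:
  fixes x :: "'i \<Rightarrow> real"
  assumes S: "finite S" "S \<noteq> {}" and x: "\<And>i. i \<in> S \<Longrightarrow> 0 \<le> x i"
  shows "((\<Sum>i\<in>S. x i) / card S) ^ k \<le> (\<Sum>i\<in>S. x i ^ k) / card S"
proof -
  have "convex_on {0..} (\<lambda>t::real. t ^ k)"
    by (cases "even k") (auto intro: convex_on_subset[OF convex_power_even] convex_power_odd)
  then have "(\<Sum>i\<in>S. (1 / card S) *\<^sub>R x i) ^ k \<le> (\<Sum>i\<in>S. (1 / card S) * x i ^ k)"
    using S x by (intro convex_on_sum) auto
  then show ?thesis by (simp add: sum_divide_distrib)
qed

lemma sum_powers_le_of_le_sum3: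
  fixes x y a b c :: real
  assumes "0 \<le> x" "0 \<le> y" "0 \<le> a" "0 \<le> b" "0 \<le> c" "x + y \<le> a + b + c"
  shows "x ^ k + y ^ k \<le> 2 * 3 ^ k * (a ^ k + b ^ k + c ^ k)"
proof -
  have "x ^ k + y ^ k \<le> 2 * (a + b + c) ^ k"
    using power_mono[of x "a + b + c" k] power_mono[of y "a + b + c" k] assms by simp
  also have "(a + b + c) ^ k \<le> (3 * max a (max b c)) ^ k"
    using assms by (intro power_mono) auto
  also have "\<dots> = 3 ^ k * max a (max b c) ^ k" by (simp add: power_mult_distrib)
  also have "max a (max b c) ^ k \<le> a ^ k + b ^ k + c ^ k"
    using assms by (auto simp: max_def)
  finally show ?thesis by simp
qed

lemma (in prob_space) nn_integral_le_of_moment_bounds: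
  fixes Z :: "nat \<Rightarrow> 'a \<Rightarrow> real" and g :: "'a \<Rightarrow> real"
  assumes Z: "\<And>j. Z j \<in> borel_measurable M" "\<And>j \<omega>. 0 \<le> Z j \<omega>"
    and mom: "\<And>j. j \<le> n \<Longrightarrow> (\<integral>\<^sup>+\<omega>. ennreal (Z j \<omega>) \<partial>M) \<le> ennreal C" and C: "0 \<le> C"
    and g: "\<And>\<omega>. g \<omega> \<le> \<alpha> + \<beta> * Z n \<omega> + \<gamma> * ((\<Sum>j\<le>n. Z j \<omega>) / (n + 1))"
    and coeffs: "0 \<le> \<alpha>" "0 \<le> \<beta>" "0 \<le> \<gamma>"
  shows "(\<integral>\<^sup>+\<omega>. ennreal (g \<omega>) \<partial>M) \<le> ennreal (\<alpha> + (\<beta> + \<gamma>) * C)"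
proof -
  define \<gamma>' where "\<gamma>' = \<gamma> / (n + 1)"
  have \<gamma>': "0 \<le> \<gamma>'" unfolding \<gamma>'_def using coeffs by simp
  have "ennreal (g \<omega>) \<le> ennreal \<alpha> + ennreal \<beta> * ennreal (Z n \<omega>) + ennreal \<gamma>' * (\<Sum>j\<le>n. ennreal (Z j \<omega>))"
    for \<omega>
  proof -
    have "g \<omega> \<le> \<alpha> + \<beta> * Z n \<omega> + \<gamma>' * (\<Sum>j\<le>n. Z j \<omega>)"
      using g[of \<omega>] unfolding \<gamma>'_def by (simp add: mult_ac)
    then have "ennreal (g \<omega>) \<le> ennreal (\<alpha> + \<beta> * Z n \<omega> + \<gamma>' * (\<Sum>j\<le>n. Z j \<omega>))"
      by (rule ennreal_leI)
    also have "\<dots> = ennreal \<alpha> + ennreal \<beta> * ennreal (Z n \<omega>) + ennreal \<gamma>' * (\<Sum>j\<le>n. ennreal (Z j \<omega>))"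
      using coeffs \<gamma>' Z(2) by (simp add: ennreal_mult sum_nonneg flip: sum_ennreal)
    finally show ?thesis .
  qed
  then have "(\<integral>\<^sup>+\<omega>. ennreal (g \<omega>) \<partial>M)
      \<le> (\<integral>\<^sup>+\<omega>. ennreal \<alpha> + ennreal \<beta> * ennreal (Z n \<omega>) + ennreal \<gamma>' * (\<Sum>j\<le>n. ennreal (Z j \<omega>)) \<partial>M)"
    by (rule nn_integral_mono)
  also have "\<dots> = ennreal \<alpha> + ennreal \<beta> * (\<integral>\<^sup>+\<omega>. ennreal (Z n \<omega>) \<partial>M)
      + ennreal \<gamma>' * (\<Sum>j\<le>n. \<integral>\<^sup>+\<omega>. ennreal (Z j \<omega>) \<partial>M)"
    using Z(1) by (simp add: nn_integral_add nn_integral_cmult nn_integral_sum emeasure_space_1)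
  also have "\<dots> \<le> ennreal \<alpha> + ennreal \<beta> * ennreal C + ennreal \<gamma>' * (\<Sum>j\<le>n. ennreal C)"
    by (intro add_mono mult_left_mono sum_mono mom order_refl) auto
  also have "\<dots> = ennreal (\<alpha> + \<beta> * C + \<gamma>' * ((n + 1) * C))"
    using coeffs \<gamma>' C by (simp add: ennreal_mult ennreal_of_nat_eq_real_of_nat)
  also have "\<gamma>' * ((n + 1) * C) = \<gamma> * C" unfolding \<gamma>'_def by (simp add: field_simps)
  finally show ?thesis by (simp add: algebra_simps)
qed

locale splitting_scheme =
  fixes F :: "real^'d \<Rightarrow> real" and M :: "real^'d^'d" and \<sigma> :: "real^'m^'d"
    and v L Cf :: real
  assumes smooth: "smooth_fun F" and v: "0 < v" and L: "0 \<le> L" and Cf: "0 \<le> Cf"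
    and lip: "\<forall>q1 q2. norm (grad F q1 - grad F q2) \<le> L * norm (q1 - q2)"
    and growth: "\<forall>x. norm (grad F x) \<le> Cf * (1 + norm x)"
begin

definition admissible_step :: "real \<Rightarrow> bool" where
  "admissible_step h \<longleftrightarrow> 0 < h \<and> h \<le> 1 \<and> v * h \<le> 1
     \<and> h * (real CARD('d) * real CARD('d) * L * onorm ((*v) M)) \<le> 1"

lemma admissible_step_threshold: "\<exists>h0>0. \<forall>h. 0 < h \<longrightarrow> h \<le> h0 \<longrightarrow> admissible_step h"
proof -
  define \<beta> where "\<beta> = real CARD('d) * real CARD('d) * L * onorm ((*v) M)"
  have \<beta>: "0 \<le> \<beta>" unfolding \<beta>_def using L onorm_pos_le[of "(*v) M"] by simp
  have "admissible_step h" if "0 < h" "h \<le> 1 / (1 + v + \<beta>)" for h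
  proof -
    have "h * (1 + v + \<beta>) \<le> 1" using that v \<beta> by (simp add: le_divide_eq)
    moreover have "0 \<le> v * h" "0 \<le> h * \<beta>" using that(1) v \<beta> by simp_all
    ultimately show ?thesis unfolding admissible_step_def \<beta>_def[symmetric]
      using that(1) by (simp add: algebra_simps)
  qed
  moreover have "0 < 1 / (1 + v + \<beta>)" using v \<beta> by simp
  ultimately show ?thesis by blast
qed

lemma norm_hess_perturbation_le:
  assumes "admissible_step h"
  shows "norm (((h\<^sup>2 / 2) *\<^sub>R (hess F y ** M)) *v x) \<le> h / 2 * norm x"
proof -
  define \<beta> where "\<beta> = real CARD('d) * real CARD('d) * L"
  have "norm (hess F y *v (M *v x)) \<le> \<beta> * norm (M *v x)"
    using onorm[OF matrix_vector_mul_bounded_linear, of "hess F y" "M *v x"]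
      onorm_hess_le[OF smooth lip, of y] unfolding \<beta>_def
    by (meson mult_right_mono norm_ge_zero order_trans)
  also have "\<dots> \<le> \<beta> * (onorm ((*v) M) * norm x)"
    using onorm[OF matrix_vector_mul_bounded_linear, of M x] L unfolding \<beta>_def
    by (intro mult_left_mono) auto
  finally have "h\<^sup>2 / 2 * norm (hess F y *v (M *v x)) \<le> h\<^sup>2 / 2 * (\<beta> * (onorm ((*v) M) * norm x))"
    by (simp add: mult_left_mono)
  then have "norm (((h\<^sup>2 / 2) *\<^sub>R (hess F y ** M)) *v x) \<le> h / 2 * (h * \<beta> * onorm ((*v) M)) * norm x"
    by (simp add: scaleR_matrix_vector_assoc[symmetric] matrix_vector_mul_assoc power2_eq_square
        mult_ac)
  also have "\<dots> \<le> h / 2 * 1 * norm x"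
    using assms unfolding admissible_step_def \<beta>_def
    by (intro mult_right_mono mult_left_mono) (auto simp: mult_ac)
  finally show ?thesis by simp
qed

lemma scheme_damped_splitting_recursion:
  assumes h: "admissible_step h"
  shows "damped_splitting_recursion
    (\<lambda>n. fst (scheme h v M \<sigma> F p q W n \<omega>)) (\<lambda>n. snd (scheme h v M \<sigma> F p q W n \<omega>))
    (\<lambda>n. \<sigma> *v (W (real n * h) \<omega> - W 0 \<omega>)) (grad F) ((*v) M)
    h (exp (- v * h)) (h * (1 + v * h / 2) * exp (- v * h)) ((1 + v * h / 2) * exp (- v * h))
    (h * (1 - v * h / 2) * exp (v * h)) (h / 2) v (onorm ((*v) M)) (exp v) Cf"
proof -
  define P where "P n = fst (scheme h v M \<sigma> F p q W n \<omega>)" for n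
  define Q where "Q n = snd (scheme h v M \<sigma> F p q W n \<omega>)" for n
  define D where "D n = \<sigma> *v (W (real n * h) \<omega> - W 0 \<omega>)" for n
  define E where "E n = (h\<^sup>2 / 2) *\<^sub>R (hess F (Q n) ** M)" for n
  define y where "y n = exp (- v * h) *\<^sub>R P n - (h * (1 + v * h / 2) * exp (- v * h)) *\<^sub>R grad F (Q n)
    - ((1 + v * h / 2) * exp (- v * h)) *\<^sub>R (D (Suc n) - D n)" for n
  have h_pos: "0 < h" "h \<le> 1" and vh: "0 \<le> v * h" "v * h \<le> 1"
    using h v unfolding admissible_step_def by auto
  have dD: "\<sigma> *v (W (real (Suc n) * h) \<omega> - W (real n * h) \<omega>) = D (Suc n) - D n" for n
    unfolding D_def by (simp add: matrix_vector_mult_diff_distrib del: of_nat_Suc)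
  have P_Suc: "P (Suc n) = matrix_inv (mat 1 + E n) *v y n" for n
    unfolding P_def Q_def E_def y_def by (simp add: Let_def dD del: of_nat_Suc)
  have Q_Suc: "Q (Suc n) = Q n + (h * (1 - v * h / 2) * exp (v * h)) *\<^sub>R (M *v P (Suc n))
      + (h\<^sup>2 / 2) *\<^sub>R (M *v grad F (Q n)) + (h / 2) *\<^sub>R (M *v (D (Suc n) - D n))" for n
    unfolding P_Suc unfolding P_def Q_def E_def y_def by (simp add: Let_def dD del: of_nat_Suc)
  have residual: "norm (P (Suc n) - y n) \<le> h / 2 * norm (P (Suc n))" for n
  proof -
    have "P (Suc n) + E n *v P (Suc n) = y n"
      using matrix_inv_perturbed_identity[of "E n" "h / 2" "y n"] norm_hess_perturbation_le[OF h] h_pos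
      unfolding P_Suc E_def by (simp add: matrix_vector_mult_add_rdistrib)
    then have "norm (P (Suc n) - y n) = norm (E n *v P (Suc n))"
      by (metis add_diff_cancel_left' norm_minus_commute)
    then show ?thesis using norm_hess_perturbation_le[OF h] unfolding E_def by simp
  qed
  have c: "0 \<le> (1 + v * h / 2) * exp (- v * h)" "(1 + v * h / 2) * exp (- v * h) \<le> 1"
    using vh exp_neg_damping_le_one[of "v * h"] by simp_all
  have e: "\<bar>h * (1 - v * h / 2) * exp (v * h)\<bar> \<le> exp v * h"
  proof -
    have "\<bar>1 - v * h / 2\<bar> * exp (v * h) \<le> 1 * exp v"
      using vh h_pos v by (intro mult_mono) (auto simp: mult_left_le)
    then show ?thesis using h_pos by (simp add: abs_mult mult_ac mult_left_mono)
  qed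
  show ?thesis
  proof (rule damped_splitting_recursion.intro, fold P_def Q_def D_def)
    show "norm (P (Suc n) - (exp (- v * h) *\<^sub>R P n - (h * (1 + v * h / 2) * exp (- v * h)) *\<^sub>R grad F (Q n)
        - ((1 + v * h / 2) * exp (- v * h)) *\<^sub>R (D (Suc n) - D n))) \<le> h / 2 * norm (P (Suc n))" for n
      using residual[of n] unfolding y_def .
    show "Q (Suc n) = Q n + (h * (1 - v * h / 2) * exp (v * h)) *\<^sub>R (M *v P (Suc n))
      + (h\<^sup>2 / 2) *\<^sub>R (M *v grad F (Q n)) + (h / 2) *\<^sub>R (M *v (D (Suc n) - D n))" for n
      by (rule Q_Suc)
    show "1 - exp (- v * h) \<le> v * h" using exp_ge_add_one_self[of "- v * h"] by simp
    show "h * (1 + v * h / 2) * exp (- v * h) \<le> h"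
      using c h_pos by (simp add: mult.assoc mult_left_le)
    show "norm (M *v x) \<le> onorm ((*v) M) * norm x" for x
      by (rule onorm[OF matrix_vector_mul_bounded_linear])
  qed (use h_pos vh c e growth Cf v onorm_pos_le[OF matrix_vector_mul_bounded_linear, of M]
      in \<open>auto simp: D_def\<close>)
qed

lemma scheme_pathwise_norm_bound:
  assumes T: "0 \<le> T"
  shows "\<exists>c1 c2 c3. 0 \<le> c1 \<and> 0 \<le> c2 \<and> 0 \<le> c3 \<and>
    (\<forall>h n \<omega>. admissible_step h \<longrightarrow> real n * h \<le> T \<longrightarrow>
      norm (fst (scheme h v M \<sigma> F p q W n \<omega>)) + norm (snd (scheme h v M \<sigma> F p q W n \<omega>))
        \<le> c1 + c2 * norm (W (real n * h) \<omega> - W 0 \<omega>)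
           + c3 * ((\<Sum>j\<le>n. norm (W (real j * h) \<omega> - W 0 \<omega>)) / (n + 1)))"
proof -
  define m0 where "m0 = onorm ((*v) M)"
  define s0 where "s0 = onorm ((*v) \<sigma>)"
  define K where "K = splitting_rate Cf m0 (exp v) v"
  define B where "B = exp (K * T)"
  have m0: "0 \<le> m0" and s0: "0 \<le> s0"
    unfolding m0_def s0_def by (simp_all add: onorm_pos_le)
  have K: "0 \<le> K" unfolding K_def splitting_rate_def using Cf m0 v by simp
  have B: "0 \<le> B" unfolding B_def by simp
  have "norm (fst (scheme h v M \<sigma> F p q W n \<omega>)) + norm (snd (scheme h v M \<sigma> F p q W n \<omega>))
      \<le> B * (norm p + norm q + K * T) + (1 + m0) * s0 * norm (W (real n * h) \<omega> - W 0 \<omega>)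
        + 2 * B * K * s0 * (T + 1) * ((\<Sum>j\<le>n. norm (W (real j * h) \<omega> - W 0 \<omega>)) / (n + 1))"
    if h: "admissible_step h" and n: "real n * h \<le> T" for h n \<omega>
  proof -
    interpret damped_splitting_recursion
      "\<lambda>n. fst (scheme h v M \<sigma> F p q W n \<omega>)" "\<lambda>n. snd (scheme h v M \<sigma> F p q W n \<omega>)"
      "\<lambda>n. \<sigma> *v (W (real n * h) \<omega> - W 0 \<omega>)" "grad F" "(*v) M"
      h "exp (- v * h)" "h * (1 + v * h / 2) * exp (- v * h)" "(1 + v * h / 2) * exp (- v * h)"
      "h * (1 - v * h / 2) * exp (v * h)" "h / 2" v m0 "exp v" Cf
      using scheme_damped_splitting_recursion[OF h] unfolding m0_def .
    define X where "X j = norm (W (real j * h) \<omega> - W 0 \<omega>)" for j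
    have X: "0 \<le> X j" for j unfolding X_def by simp
    have D: "norm (\<sigma> *v (W (real j * h) \<omega> - W 0 \<omega>)) \<le> s0 * X j" for j
      unfolding s0_def X_def by (rule onorm[OF matrix_vector_mul_bounded_linear])
    have growth_le: "(1 + h * K) ^ n \<le> B"
    proof -
      have "(1 + h * K) ^ n \<le> exp (h * K) ^ n"
        using h K by (intro power_mono) (auto simp: admissible_step_def)
      also have "\<dots> = exp (K * (real n * h))" by (simp add: mult_ac flip: exp_of_nat_mult)
      also have "\<dots> \<le> B" unfolding B_def using n K by (simp add: mult_left_mono)
      finally show ?thesis .
    qed
    have sum_le: "h * (\<Sum>j\<le>n. norm (\<sigma> *v (W (real j * h) \<omega> - W 0 \<omega>)))
        \<le> s0 * (T + 1) * ((\<Sum>j\<le>n. X j) / (n + 1))"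
    proof -
      have "h * (\<Sum>j\<le>n. norm (\<sigma> *v (W (real j * h) \<omega> - W 0 \<omega>))) \<le> h * (s0 * (\<Sum>j\<le>n. X j))"
        using h D by (intro mult_left_mono) (auto simp: sum_distrib_left admissible_step_def intro: sum_mono)
      also have "\<dots> = s0 * (h * (n + 1)) * ((\<Sum>j\<le>n. X j) / (n + 1))" by simp
      also have "\<dots> \<le> s0 * (T + 1) * ((\<Sum>j\<le>n. X j) / (n + 1))"
        using n h s0 X by (intro mult_right_mono mult_left_mono)
          (auto simp: algebra_simps admissible_step_def sum_nonneg)
      finally show ?thesis .
    qed
    have "norm p + norm q + h * K * (n + 2 * (\<Sum>j\<le>n. norm (\<sigma> *v (W (real j * h) \<omega> - W 0 \<omega>))))
        \<le> norm p + norm q + K * T + 2 * K * (s0 * (T + 1) * ((\<Sum>j\<le>n. X j) / (n + 1)))"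
      using mult_left_mono[OF n K] mult_left_mono[OF sum_le, of "2 * K"] K by (simp add: algebra_simps)
    then have "(1 + h * K) ^ n * (norm p + norm q + h * K * (n + 2 * (\<Sum>j\<le>n. norm (\<sigma> *v (W (real j * h) \<omega> - W 0 \<omega>)))))
        \<le> B * (norm p + norm q + K * T + 2 * K * (s0 * (T + 1) * ((\<Sum>j\<le>n. X j) / (n + 1))))"
      using growth_le h K B
      by (intro mult_mono) (auto simp: admissible_step_def intro!: add_nonneg_nonneg mult_nonneg_nonneg sum_nonneg)
    moreover have "(1 + m0) * norm (\<sigma> *v (W (real n * h) \<omega> - W 0 \<omega>)) \<le> (1 + m0) * (s0 * X n)"
      using D m0 by (intro mult_left_mono) auto
    moreover have "B * (norm p + norm q + K * T + 2 * K * (s0 * (T + 1) * ((\<Sum>j\<le>n. X j) / (n + 1))))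
        = B * (norm p + norm q + K * T) + 2 * B * K * s0 * (T + 1) * ((\<Sum>j\<le>n. X j) / (n + 1))"
      by (simp add: algebra_simps add_divide_distrib)
    ultimately show ?thesis
      using norm_P_add_norm_Q_le[of n] unfolding K_def[symmetric] scheme.simps(1) fst_conv snd_conv
      unfolding X_def by linarith
  qed
  moreover have "0 \<le> B * (norm p + norm q + K * T)" "0 \<le> (1 + m0) * s0" "0 \<le> 2 * B * K * s0 * (T + 1)"
    using B K T m0 s0 by simp_all
  ultimately show ?thesis by blast
qed

lemma scheme_pathwise_power_bound:
  assumes T: "0 \<le> T"
  shows "\<exists>c1 c2 c3. 0 \<le> c1 \<and> 0 \<le> c2 \<and> 0 \<le> c3 \<and>
    (\<forall>h n \<omega>. admissible_step h \<longrightarrow> real n * h \<le> T \<longrightarrow>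
      norm (fst (scheme h v M \<sigma> F p q W n \<omega>)) ^ k + norm (snd (scheme h v M \<sigma> F p q W n \<omega>)) ^ k
        \<le> 2 * 3 ^ k * (c1 ^ k + c2 ^ k * norm (W (real n * h) \<omega> - W 0 \<omega>) ^ k
           + c3 ^ k * ((\<Sum>j\<le>n. norm (W (real j * h) \<omega> - W 0 \<omega>) ^ k) / (n + 1))))"
proof -
  obtain c1 c2 c3 where c: "0 \<le> c1" "0 \<le> c2" "0 \<le> c3" and bound:
    "\<And>h n \<omega>. admissible_step h \<Longrightarrow> real n * h \<le> T \<Longrightarrow>
      norm (fst (scheme h v M \<sigma> F p q W n \<omega>)) + norm (snd (scheme h v M \<sigma> F p q W n \<omega>))
        \<le> c1 + c2 * norm (W (real n * h) \<omega> - W 0 \<omega>)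
           + c3 * ((\<Sum>j\<le>n. norm (W (real j * h) \<omega> - W 0 \<omega>)) / (n + 1))"
    using scheme_pathwise_norm_bound[OF T] by blast
  have "norm (fst (scheme h v M \<sigma> F p q W n \<omega>)) ^ k + norm (snd (scheme h v M \<sigma> F p q W n \<omega>)) ^ k
      \<le> 2 * 3 ^ k * (c1 ^ k + c2 ^ k * norm (W (real n * h) \<omega> - W 0 \<omega>) ^ k
         + c3 ^ k * ((\<Sum>j\<le>n. norm (W (real j * h) \<omega> - W 0 \<omega>) ^ k) / (n + 1)))"
    if h: "admissible_step h" and n: "real n * h \<le> T" for h n \<omega>
  proof -
    define X where "X j = norm (W (real j * h) \<omega> - W 0 \<omega>)" for j
    have X: "0 \<le> X j" for j unfolding X_def by simp
    have "norm (fst (scheme h v M \<sigma> F p q W n \<omega>)) ^ k + norm (snd (scheme h v M \<sigma> F p q W n \<omega>)) ^ k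
        \<le> 2 * 3 ^ k * (c1 ^ k + (c2 * X n) ^ k + (c3 * ((\<Sum>j\<le>n. X j) / (n + 1))) ^ k)"
      using bound[OF h n, of \<omega>] c X unfolding X_def[symmetric]
      by (intro sum_powers_le_of_le_sum3) (auto intro!: sum_nonneg divide_nonneg_nonneg mult_nonneg_nonneg)
    also have "(c3 * ((\<Sum>j\<le>n. X j) / (n + 1))) ^ k \<le> c3 ^ k * ((\<Sum>j\<le>n. X j ^ k) / (n + 1))"
      unfolding power_mult_distrib using power_mean_le_mean_power[of "{..n}" X k] X c(3)
      by (intro mult_left_mono) simp_all
    finally show ?thesis unfolding X_def by (simp add: power_mult_distrib)
  qed
  with c show ?thesis by blast
qed

lemma scheme_moment_bound:
  assumes W: "wiener_process \<Omega> W" and T: "0 \<le> T"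
  shows "\<exists>C. \<forall>h n. admissible_step h \<longrightarrow> real n * h \<le> T \<longrightarrow>
    (\<integral>\<^sup>+\<omega>. ennreal (norm (fst (scheme h v M \<sigma> F p q W n \<omega>)) ^ k
                    + norm (snd (scheme h v M \<sigma> F p q W n \<omega>)) ^ k) \<partial>\<Omega>) \<le> ennreal C"
proof -
  interpret prob_space \<Omega> using W unfolding wiener_process_def by blast
  have [measurable]: "W t \<in> borel_measurable \<Omega>" for t
    using W unfolding wiener_process_def by blast
  obtain c1 c2 c3 where c: "0 \<le> c1" "0 \<le> c2" "0 \<le> c3" and bound:
    "\<And>h n \<omega>. admissible_step h \<Longrightarrow> real n * h \<le> T \<Longrightarrow>
      norm (fst (scheme h v M \<sigma> F p q W n \<omega>)) ^ k + norm (snd (scheme h v M \<sigma> F p q W n \<omega>)) ^ k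
        \<le> 2 * 3 ^ k * (c1 ^ k + c2 ^ k * norm (W (real n * h) \<omega> - W 0 \<omega>) ^ k
           + c3 ^ k * ((\<Sum>j\<le>n. norm (W (real j * h) \<omega> - W 0 \<omega>) ^ k) / (n + 1)))"
    using scheme_pathwise_power_bound[OF T] by blast
  define Cm where "Cm = real CARD('m) ^ k * (real CARD('m) * (1 + fact (2 * k) * T ^ k))"
  have "(\<integral>\<^sup>+\<omega>. ennreal (norm (fst (scheme h v M \<sigma> F p q W n \<omega>)) ^ k
                    + norm (snd (scheme h v M \<sigma> F p q W n \<omega>)) ^ k) \<partial>\<Omega>)
      \<le> ennreal (2 * 3 ^ k * c1 ^ k + (2 * 3 ^ k * c2 ^ k + 2 * 3 ^ k * c3 ^ k) * Cm)"
    if h: "admissible_step h" and n: "real n * h \<le> T" for h n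
  proof (rule nn_integral_le_of_moment_bounds[where Z = "\<lambda>j \<omega>. norm (W (real j * h) \<omega> - W 0 \<omega>) ^ k"
        and n = n])
    show "(\<integral>\<^sup>+\<omega>. ennreal (norm (W (real j * h) \<omega> - W 0 \<omega>) ^ k) \<partial>\<Omega>) \<le> ennreal Cm"
      if "j \<le> n" for j
    proof -
      have "real j * h \<le> T"
        using that n h by (meson admissible_step_def less_imp_le mult_right_mono of_nat_le_iff order_trans)
      then show ?thesis unfolding Cm_def
        using h by (intro wiener_increment_norm_power_moment[OF W]) (auto simp: admissible_step_def)
    qed
  qed (use bound[OF h n] c T in \<open>auto simp: Cm_def algebra_simps\<close>)
  then show ?thesis by blast
qed

end

theorem theorem4p2:
  fixes \<Omega> :: "'a measure"
    and W :: "real \<Rightarrow> 'a \<Rightarrow> real^'m"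
    and F :: "real^'d \<Rightarrow> real"
    and M :: "real^'d^'d"
    and \<sigma> :: "real^'m^'d"
    and v T L Cf :: real
    and p q :: "real^'d"
    and k :: nat
  assumes dm: "CARD('d) \<le> CARD('m)"
    and W: "wiener_process \<Omega> W"
    and F: "smooth_fun F"
    and M: "sym_pos_def_mat M"
    and v: "v > 0"
    and L: "L \<ge> 0" and Cf: "Cf \<ge> 0"
    and lip: "\<forall>q1 q2. norm (grad F q1 - grad F q2) \<le> L * norm (q1 - q2)"
    and growth: "\<forall>x. norm (grad F x) \<le> Cf * (1 + norm x)"
    and T: "T > 0"
  shows "\<exists>h0 > 0. \<exists>C :: real. \<forall>h (N :: nat). 0 < h \<longrightarrow> h \<le> h0 \<longrightarrow> real N * h = T \<longrightarrow>
           (\<forall>n \<in> {1..N}.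
              (\<integral>\<^sup>+ \<omega>. ennreal (norm (fst (scheme h v M \<sigma> F p q W n \<omega>)) ^ k
                              + norm (snd (scheme h v M \<sigma> F p q W n \<omega>)) ^ k) \<partial>\<Omega>)
              \<le> ennreal C)"
proof -
  interpret splitting_scheme F M \<sigma> v L Cf
    using F v L Cf lip growth by unfold_locales
  obtain C where C: "\<And>h n. admissible_step h \<Longrightarrow> real n * h \<le> T \<Longrightarrow>
      (\<integral>\<^sup>+ \<omega>. ennreal (norm (fst (scheme h v M \<sigma> F p q W n \<omega>)) ^ k
                      + norm (snd (scheme h v M \<sigma> F p q W n \<omega>)) ^ k) \<partial>\<Omega>) \<le> ennreal C"
    using scheme_moment_bound[OF W, of T p q k] T by auto
  obtain h0 where h0: "0 < h0" "\<And>h. 0 < h \<Longrightarrow> h \<le> h0 \<Longrightarrow> admissible_step h"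
    using admissible_step_threshold by blast
  have "real n * h \<le> T" if "n \<in> {1..N}" "real N * h = T" "0 < h" for h and n N :: nat
    using that by (metis atLeastAtMost_iff mult_right_mono of_nat_le_iff less_imp_le)
  then show ?thesis using h0 C by blast
qed

end
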